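(* Let $k\ge 3$ be an integer and let $G$ be a $k$-regular graph. The strong chromatic index of $G$ equals $2k-1$ if and only if $G$ covers the Kneser graph $K(2k-1,k-1)$, i.e., there is a covering projection $G\to K(2k-1,k-1)$.
   Context: A strong edge coloring of a graph is a proper edge coloring with no bichromatic path of length three; the strong chromatic index $\chi_s'(G)$ is the minimum number of colors in a strong edge coloring of $G$. For $m\ge 2n+1$ and $n\ge 2$, the Kneser graph $K(m,n)$ has as vertices the $n$-element subsets of $\{1,\dots,m\}$, two vertices being adjacent iff the subsets are disjoint. A surjective graph homomorphism $f\colon\tilde G\to G$ is a covering projection if for every vertex $\tilde v$ of $\tilde G$ the set of edges incident with $\tilde v$ is mapped bijectively onto the set of edges incident with $f(\tilde v)$; $\tilde G$ covers $G$ if such a projection exists. *)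

theory Defs
  imports Main "HOL-Library.Extended_Nat"
begin

text \<open>Graphs are simple, given by a vertex set and a set of two-element edges.
  They are not required to be finite.\<close>

definition simple_graph :: "'a set \<Rightarrow> 'a set set \<Rightarrow> bool" where
  "simple_graph V E \<longleftrightarrow> (\<forall>e\<in>E. e \<subseteq> V \<and> card e = 2)"

definition incident_edges :: "'a set set \<Rightarrow> 'a \<Rightarrow> 'a set set" where
  "incident_edges E v = {e \<in> E. v \<in> e}"

text \<open>For \<open>k > 0\<close> this forces every vertex to have finite degree, since the cardinality of an
  infinite set is 0.\<close>

definition regular_graph :: "nat \<Rightarrow> 'a set \<Rightarrow> 'a set set \<Rightarrow> bool" where
  "regular_graph k V E \<longleftrightarrow>
     simple_graph V E \<and> (\<forall>v\<in>V. card (incident_edges E v) = k)"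

definition proper_edge_coloring :: "'a set set \<Rightarrow> ('a set \<Rightarrow> 'c) \<Rightarrow> bool" where
  "proper_edge_coloring E c \<longleftrightarrow>
     (\<forall>e\<in>E. \<forall>e'\<in>E. e \<noteq> e' \<and> e \<inter> e' \<noteq> {} \<longrightarrow> c e \<noteq> c e')"

definition bichromatic_path3 ::
    "'a set set \<Rightarrow> ('a set \<Rightarrow> 'c) \<Rightarrow> 'a \<Rightarrow> 'a \<Rightarrow> 'a \<Rightarrow> 'a \<Rightarrow> bool" where
  "bichromatic_path3 E c u v w x \<longleftrightarrow>
     distinct [u, v, w, x] \<and> {u, v} \<in> E \<and> {v, w} \<in> E \<and> {w, x} \<in> E \<and>
     card {c {u, v}, c {v, w}, c {w, x}} = 2"

definition strong_edge_coloring :: "'a set set \<Rightarrow> ('a set \<Rightarrow> 'c) \<Rightarrow> bool" where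
  "strong_edge_coloring E c \<longleftrightarrow>
     proper_edge_coloring E c \<and> \<not> (\<exists>u v w x. bichromatic_path3 E c u v w x)"

text \<open>The minimum over all numbers of colors that suffice. It is \<open>\<infinity>\<close> exactly if no finite number
  of colors does, which can only happen for infinite graphs.\<close>

definition strong_chromatic_index :: "'a set set \<Rightarrow> enat" where
  "strong_chromatic_index E =
     Inf {enat n | n. \<exists>c :: 'a set \<Rightarrow> nat. strong_edge_coloring E c \<and> c ` E \<subseteq> {..<n}}"

definition kneser_vertices :: "nat \<Rightarrow> nat \<Rightarrow> nat set set" where
  "kneser_vertices m n = {A. A \<subseteq> {1..m} \<and> card A = n}"

definition kneser_edges :: "nat \<Rightarrow> nat \<Rightarrow> nat set set set" where
  "kneser_edges m n =
     {{A, B} | A B. A \<in> kneser_vertices m n \<and> B \<in> kneser_vertices m n \<and> A \<inter> B = {}}"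

text \<open>For \<open>n = 0\<close> the only candidate edge would be the degenerate \<open>{{}}\<close>.\<close>

lemma simple_graph_kneser:
  assumes "n > 0"
  shows "simple_graph (kneser_vertices m n) (kneser_edges m n)"
proof -
  have "A \<noteq> B" if "A \<in> kneser_vertices m n" "A \<inter> B = {}" for A B
    using that assms by (auto simp: kneser_vertices_def)
  then show ?thesis
    unfolding simple_graph_def kneser_edges_def by fastforce
qed

definition graph_homomorphism ::
    "('a \<Rightarrow> 'b) \<Rightarrow> 'a set \<Rightarrow> 'a set set \<Rightarrow> 'b set \<Rightarrow> 'b set set \<Rightarrow> bool" where
  "graph_homomorphism f V E V' E' \<longleftrightarrow> f ` V \<subseteq> V' \<and> (\<forall>e\<in>E. f ` e \<in> E')"

text \<open>Surjectivity on vertices together with the local bijections gives surjectivity on edges.\<close>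

definition covering_projection ::
    "('a \<Rightarrow> 'b) \<Rightarrow> 'a set \<Rightarrow> 'a set set \<Rightarrow> 'b set \<Rightarrow> 'b set set \<Rightarrow> bool" where
  "covering_projection f V E V' E' \<longleftrightarrow>
     graph_homomorphism f V E V' E' \<and> f ` V = V' \<and>
     (\<forall>v\<in>V. bij_betw (\<lambda>e. f ` e) (incident_edges E v) (incident_edges E' (f v)))"

definition covers :: "'a set \<Rightarrow> 'a set set \<Rightarrow> 'b set \<Rightarrow> 'b set set \<Rightarrow> bool" where
  "covers V E V' E' \<longleftrightarrow> (\<exists>f. covering_projection f V E V' E')"

end

theory Submission
  imports Defs
begin

text \<open>In a strong edge coloring the \<open>2k - 1\<close> edges meeting a fixed edge \<open>uv\<close> have distinct colors.
  So if only \<open>2k - 1\<close> colors occur, the sets of colors missing at \<open>u\<close> and at \<open>v\<close> are disjoint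
  \<open>(k - 1)\<close>-sets whose union misses only the color of \<open>uv\<close>. Mapping each vertex to its set of missing
  colors is therefore a local bijection to the Kneser graph, and it is onto because that graph is
  connected. Conversely, given a covering \<open>f\<close>, coloring \<open>uv\<close> with the unique element outside
  \<open>f u \<union> f v\<close> gives a strong edge coloring.\<close>

section \<open>Colors on the edges meeting a fixed edge\<close>

lemma simple_graph_incident_edgeE:
  assumes "simple_graph V E" "e \<in> incident_edges E v"
  obtains u where "e = {v, u}" "u \<noteq> v" "u \<in> V" "v \<in> V" "{v, u} \<in> E"
proof -
  have e: "e \<in> E" "v \<in> e" "e \<subseteq> V" "card e = 2"
    using assms by (auto simp: simple_graph_def incident_edges_def)
  then obtain u where "e = {v, u}" "u \<noteq> v"
    by (auto simp: card_2_iff doubleton_eq_iff)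
  with e that show thesis by auto
qed

lemma incident_edges_Int:
  assumes S: "simple_graph V E" and uv: "{u, v} \<in> E"
  shows "incident_edges E u \<inter> incident_edges E v = {{u, v}}"
proof -
  have "u \<noteq> v" using S uv by (auto simp: simple_graph_def)
  then have "e = {u, v}" if "e \<in> incident_edges E u" "e \<in> incident_edges E v" for e
    using simple_graph_incident_edgeE[OF S that(1)] that(2) by (auto simp: incident_edges_def)
  then show ?thesis
    using uv by (auto simp: incident_edges_def)
qed

text \<open>Properness separates edges that share an endpoint. Two disjoint edges, one at
  \<open>u\<close> and one at \<open>v\<close>, are the outer edges of a path of length three with
  middle edge \<open>{u, v}\<close>, and equal colors on them would make that path
  bichromatic.\<close>

lemma strong_edge_coloring_inj_on:
  assumes G: "simple_graph V E" and c: "strong_edge_coloring E c" and uv: "{u, v} \<in> E"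
  shows "inj_on c (incident_edges E u \<union> incident_edges E v)"
proof -
  have proper: "c e \<noteq> c e'" if "e \<in> E" "e' \<in> E" "e \<noteq> e'" "e \<inter> e' \<noteq> {}" for e e'
    using c that by (auto simp: strong_edge_coloring_def proper_edge_coloring_def)
  \<comment> \<open>The endpoints are quantified afresh because the final case split needs this fact
    in both orientations of the edge.\<close>
  have across: "c e \<noteq> c e'"
    if uv: "{u, v} \<in> E" and e: "e \<in> incident_edges E u" "e' \<in> incident_edges E v"
      and ne: "e \<noteq> e'" for u v e e'
  proof (cases "e \<inter> e' = {}")
    case False
    with e ne show ?thesis by (intro proper) (auto simp: incident_edges_def)
  next
    case True
    obtain x where x: "e = {u, x}" "x \<noteq> u" "{u, x} \<in> E"
      using simple_graph_incident_edgeE[OF G e(1)] by blast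
    obtain y where y: "e' = {v, y}" "y \<noteq> v" "{v, y} \<in> E"
      using simple_graph_incident_edgeE[OF G e(2)] by blast
    have dist: "distinct [x, u, v, y]" using True x y by auto
    have ne1: "c {x, u} \<noteq> c {u, v}"
      using proper[of "{u, x}" "{u, v}"] x(3) uv dist by (simp add: doubleton_eq_iff insert_commute)
    have ne2: "c {u, v} \<noteq> c {v, y}"
      using proper[of "{u, v}" "{v, y}"] y(3) uv dist by (simp add: doubleton_eq_iff)
    show ?thesis
    proof
      assume "c e = c e'"
      then have "{c {x, u}, c {u, v}, c {v, y}} = {c {x, u}, c {u, v}}"
        using x y by (auto simp: insert_commute)
      then have "bichromatic_path3 E c x u v y"
        using dist x y uv ne1 by (auto simp: bichromatic_path3_def insert_commute)
      with c show False by (auto simp: strong_edge_coloring_def)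
    qed
  qed
  have vu: "{v, u} \<in> E" using uv by (simp add: insert_commute)
  have same: "c e \<noteq> c e'" if "e \<in> incident_edges E w" "e' \<in> incident_edges E w" "e \<noteq> e'" for e e' w
    using that by (intro proper) (auto simp: incident_edges_def)
  show ?thesis
  proof (rule inj_onI, rule ccontr)
    fix e e' assume "e \<in> incident_edges E u \<union> incident_edges E v"
      "e' \<in> incident_edges E u \<union> incident_edges E v" and "c e = c e'" "e \<noteq> e'"
    then show False
      using across[OF uv, of e e'] across[OF vu, of e e'] same[of e _ e'] by blast
  qed
qed

text \<open>Inclusion-exclusion: \<open>k\<close> edges at each end, with \<open>{u, v}\<close>
  itself counted twice. Positivity of \<open>k\<close> gives finiteness, as infinite sets have
  cardinality 0.\<close>

lemma card_incident_edges_Un: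
  assumes G: "regular_graph k V E" and "k > 0" and uv: "{u, v} \<in> E"
  shows "card (incident_edges E u \<union> incident_edges E v) = 2 * k - 1"
proof -
  have S: "simple_graph V E" and uv': "u \<noteq> v" "u \<in> V" "v \<in> V"
    using G uv by (auto simp: regular_graph_def simple_graph_def)
  have k: "card (incident_edges E u) = k" "card (incident_edges E v) = k"
    using G uv' by (auto simp: regular_graph_def)
  with \<open>k > 0\<close> have fin: "finite (incident_edges E u)" "finite (incident_edges E v)"
    using card.infinite by fastforce+
  show "card (incident_edges E u \<union> incident_edges E v) = 2 * k - 1"
    using card_Un_Int[OF fin] k incident_edges_Int[OF S uv] by simp
qed

lemma regular_graph_ex_edge:
  assumes "regular_graph k V E" "k > 0" "v \<in> V"
  obtains u where "{v, u} \<in> E"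
proof -
  have "incident_edges E v \<noteq> {}" using assms by (auto simp: regular_graph_def)
  then show thesis
    using that assms simple_graph_incident_edgeE unfolding regular_graph_def by (metis ex_in_conv)
qed

section \<open>Lower bound on the number of colors, and attainment of the index\<close>

lemma strong_edge_coloring_card_le:
  fixes c :: "'a set \<Rightarrow> nat"
  assumes G: "regular_graph k V E" and "k > 0" "V \<noteq> {}"
    and c: "strong_edge_coloring E c" and n: "c ` E \<subseteq> {..<n}"
  shows "2 * k - 1 \<le> n"
proof -
  obtain u v where uv: "{u, v} \<in> E"
    using regular_graph_ex_edge[OF G \<open>k > 0\<close>] \<open>V \<noteq> {}\<close> by blast
  let ?I = "incident_edges E u \<union> incident_edges E v"
  have "inj_on c ?I"
    using strong_edge_coloring_inj_on[OF _ c uv] G by (auto simp: regular_graph_def)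
  moreover have "c ` ?I \<subseteq> {..<n}" using n by (auto simp: incident_edges_def)
  ultimately have "card ?I \<le> card {..<n}" by (intro card_inj_on_le) auto
  then show ?thesis using card_incident_edges_Un[OF G \<open>k > 0\<close> uv] by simp
qed

text \<open>The infimum of the empty set in \<open>enat\<close> is infinite, so a finite index means
  that some number of colors suffices. The infimum of a nonempty set is its least element and hence
  belongs to it.\<close>

lemma strong_chromatic_index_attained:
  assumes "strong_chromatic_index (E :: 'a set set) = enat n"
  obtains c :: "'a set \<Rightarrow> nat" where "strong_edge_coloring E c" "c ` E \<subseteq> {..<n}"
proof -
  let ?S = "{enat n | n. \<exists>c :: 'a set \<Rightarrow> nat. strong_edge_coloring E c \<and> c ` E \<subseteq> {..<n}}"
  have Inf: "Inf ?S = enat n" using assms by (simp add: strong_chromatic_index_def)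
  then have "?S \<noteq> {}" by (metis Inf_empty enat.distinct(1) top_enat_def)
  then obtain x where "x \<in> ?S" by blast
  then have "(LEAST y. y \<in> ?S) \<in> ?S" by (rule LeastI)
  then have "Inf ?S \<in> ?S" using \<open>?S \<noteq> {}\<close> by (simp only: Inf_enat_def if_False)
  then show thesis using Inf that by auto
qed

section \<open>Adjacency and connectedness in the Kneser graph\<close>

lemma kneser_neighbour:
  assumes "{A, B} \<in> kneser_edges m n"
  shows "A \<in> kneser_vertices m n" "B \<in> kneser_vertices m n" "A \<inter> B = {}"
  using assms by (auto simp: kneser_edges_def doubleton_eq_iff)

text \<open>Connectedness of the odd graph: the complement of \<open>A \<union> {b}\<close> is a common neighbour of \<open>A\<close> and
  of \<open>A\<close> with one element exchanged for \<open>b\<close>.\<close>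

lemma kneser_odd_connected:
  assumes m: "m = 2 * n + 1" and SV: "S \<subseteq> kneser_vertices m n" and "A \<in> S"
    and closed: "\<And>A B. A \<in> S \<Longrightarrow> B \<in> kneser_vertices m n \<Longrightarrow> A \<inter> B = {} \<Longrightarrow> B \<in> S"
    and B: "B \<in> kneser_vertices m n"
  shows "B \<in> S"
  using \<open>A \<in> S\<close>
\<comment> \<open>Each exchange replaces an element of \<open>A - B\<close> by one of
  \<open>B - A\<close>, so the measure drops.\<close>
proof (induction "card (B - A)" arbitrary: A rule: less_induct)
  case less
  have A: "A \<subseteq> {1..m}" "card A = n" "finite A" and B': "B \<subseteq> {1..m}" "card B = n" "finite B"
    using less.prems SV B by (auto simp: kneser_vertices_def dest: finite_subset)
  show ?case
  proof (cases "A = B")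
    case True
    with less.prems show ?thesis by simp
  next
    case False
    obtain b where b: "b \<in> B" "b \<notin> A"
      using False A B' by (metis card_subset_eq subsetI)
    obtain a where a: "a \<in> A" "a \<notin> B"
      using False A B' by (metis card_subset_eq subsetI)
    define C where "C = {1..m} - insert b A"
    define A' where "A' = insert b (A - {a})"
    \<comment> \<open>Here \<open>m = 2 * n + 1\<close> matters: removing the \<open>n + 1\<close>
      elements of \<open>insert b A\<close> leaves exactly \<open>n\<close>.\<close>
    have "card C = card {1..m} - card (insert b A)"
      unfolding C_def using A b B' by (intro card_Diff_subset) auto
    then have "C \<in> kneser_vertices m n"
      using A b m by (auto simp: kneser_vertices_def C_def)
    then have "C \<in> S" using closed[OF less.prems, of C] by (auto simp: C_def)
    moreover have "card A' = n"
      using A a b by (simp add: A'_def card_Suc_Diff1 del: card_Diff_singleton card_Diff_insert)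
    then have "A' \<in> kneser_vertices m n"
      using A B' b by (auto simp: kneser_vertices_def A'_def)
    ultimately have "A' \<in> S" by (rule closed) (auto simp: C_def A'_def)
    moreover have "card (B - A') < card (B - A)"
      using a b B' by (intro psubset_card_mono) (auto simp: A'_def)
    ultimately show ?thesis by (intro less.hyps)
  qed
qed

section \<open>From a coloring with \<open>2 * k - 1\<close> colors to a covering\<close>

lemma covers_kneser_of_strong_edge_coloring:
  fixes c :: "'a set \<Rightarrow> nat"
  assumes G: "regular_graph k V E" and "k > 0" "V \<noteq> {}"
    and c: "strong_edge_coloring E c" and cE: "c ` E \<subseteq> {..<2 * k - 1}"
  shows "covers V E (kneser_vertices (2 * k - 1) (k - 1)) (kneser_edges (2 * k - 1) (k - 1))"
proof -
  define m where "m = 2 * k - 1"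
  \<comment> \<open>Colors start at 0 but the ground set of the Kneser graph starts at 1, hence the
    shift. \<open>A v\<close> collects the shifted colors present at \<open>v\<close>, and
    \<open>f v\<close> those missing there.\<close>
  define d where "d = Suc \<circ> c"
  define A where "A v = d ` incident_edges E v" for v
  define f where "f v = {1..m} - A v" for v
  have S: "simple_graph V E" using G by (simp add: regular_graph_def)
  have injd: "inj_on d (incident_edges E u \<union> incident_edges E v)" if "{u, v} \<in> E" for u v
    unfolding d_def using strong_edge_coloring_inj_on[OF S c that] by (intro comp_inj_on) auto
  have dE: "d e \<in> {1..m}" if "e \<in> E" for e
    using cE that by (fastforce simp: d_def m_def)
  have Am: "A v \<subseteq> {1..m}" for v
    using dE by (auto simp: A_def incident_edges_def)
  have finA: "finite (A v)" for v
    using Am finite_subset by blast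
  have injv: "inj_on d (incident_edges E v)" if "v \<in> V" for v
    using regular_graph_ex_edge[OF G \<open>k > 0\<close> that] injd by (metis inj_on_Un)
  have cardA: "card (A v) = k" if "v \<in> V" for v
    using card_image[OF injv[OF that]] G that by (simp add: A_def regular_graph_def)
  have fV: "f v \<in> kneser_vertices m (k - 1)" if "v \<in> V" for v
    using card_Diff_subset[OF finA Am, of v] cardA[OF that] \<open>k > 0\<close>
    by (auto simp: f_def kneser_vertices_def m_def)
  \<comment> \<open>The edges at \<open>v\<close> or \<open>u\<close> have \<open>2 * k - 1\<close>
    distinct colors, so every color is present at one end and only that of \<open>{v, u}\<close> at
    both. A color missing at \<open>u\<close> is thus one present at \<open>v\<close> other than the
    common one.\<close>
  have f_edge: "f u = A v - {d {v, u}}" if vu: "{v, u} \<in> E" for u v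
  proof -
    have inter: "A v \<inter> A u = {d {v, u}}"
      using inj_on_image_Int[OF injd[OF vu], of "incident_edges E v" "incident_edges E u"]
        incident_edges_Int[OF S vu]
      by (simp add: A_def)
    have "card (A v \<union> A u) = card {1..m}"
      using card_image[OF injd[OF vu]] card_incident_edges_Un[OF G \<open>k > 0\<close> vu]
      by (simp add: A_def m_def image_Un)
    then have "A v \<union> A u = {1..m}" using Am by (intro card_subset_eq) auto
    with inter show ?thesis by (auto simp: f_def)
  qed
  have edge: "{f v, f u} \<in> kneser_edges m (k - 1)" if vu: "{v, u} \<in> E" for u v
  proof -
    have "f v \<in> kneser_vertices m (k - 1)" "f u \<in> kneser_vertices m (k - 1)"
      using fV S vu by (auto simp: simple_graph_def)
    moreover have "f v \<inter> f u = {}" using f_edge[OF vu] by (auto simp: f_def)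
    ultimately show ?thesis unfolding kneser_edges_def by blast
  qed
  \<comment> \<open>A neighbour \<open>B\<close> of \<open>f v\<close> lies in \<open>A v\<close>
    and omits exactly one color \<open>x\<close> of it. The edge at \<open>v\<close> with color
    \<open>x\<close> leads to the desired \<open>u\<close>, by \<open>f_edge\<close>.\<close>
  have lift: "\<exists>u. {v, u} \<in> E \<and> f u = B"
    if "v \<in> V" and B: "B \<in> kneser_vertices m (k - 1)" "f v \<inter> B = {}" for v B
  proof -
    have BA: "B \<subseteq> A v" and "card B = k - 1"
      using B by (auto simp: f_def kneser_vertices_def)
    then have "card (A v - B) = 1"
      using card_Diff_subset[of B "A v"] finite_subset[OF BA finA] cardA[OF \<open>v \<in> V\<close>] \<open>k > 0\<close> by simp
    then obtain x where x: "A v - B = {x}" by (auto simp: card_1_singleton_iff)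
    then have "x \<in> A v" by blast
    then obtain e where e: "e \<in> incident_edges E v" "x = d e" by (auto simp: A_def)
    obtain u where u: "e = {v, u}" "{v, u} \<in> E" using simple_graph_incident_edgeE[OF S e(1)] by blast
    have "B = A v - {x}" using x BA by blast
    with f_edge[OF u(2)] e u show ?thesis by metis
  qed
  have hom: "graph_homomorphism f V E (kneser_vertices m (k - 1)) (kneser_edges m (k - 1))"
    unfolding graph_homomorphism_def
  proof (intro conjI ballI)
    show "f ` V \<subseteq> kneser_vertices m (k - 1)" using fV by blast
    fix e assume "e \<in> E"
    moreover from this obtain v u where "e = {v, u}"
      using S unfolding simple_graph_def by (metis card_2_iff)
    ultimately show "f ` e \<in> kneser_edges m (k - 1)" using edge by simp
  qed
  have bij: "bij_betw ((`) f) (incident_edges E v) (incident_edges (kneser_edges m (k - 1)) (f v))"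
    if v: "v \<in> V" for v
    unfolding bij_betw_def
  proof (intro conjI equalityI subsetI)
    show "inj_on ((`) f) (incident_edges E v)"
    proof (rule inj_onI)
      fix e e' assume e: "e \<in> incident_edges E v" "e' \<in> incident_edges E v" and eq: "f ` e = f ` e'"
      obtain u where u: "e = {v, u}" "{v, u} \<in> E" using simple_graph_incident_edgeE[OF S e(1)] by blast
      obtain w where w: "e' = {v, w}" "{v, w} \<in> E" using simple_graph_incident_edgeE[OF S e(2)] by blast
      have "f u = f w" using eq u w by (auto simp: doubleton_eq_iff)
      moreover have "d e \<in> A v" "d e' \<in> A v" using e by (auto simp: A_def)
      \<comment> \<open>Both colors lie in \<open>A v\<close>, and removing either one leaves the
        same set \<open>f u = f w\<close>.\<close>
      ultimately have "d e = d e'" using f_edge[OF u(2)] f_edge[OF w(2)] u w by auto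
      then show "e = e'" using inj_onD[OF injv[OF v]] e by blast
    qed
  next
    fix X assume "X \<in> (`) f ` incident_edges E v"
    then show "X \<in> incident_edges (kneser_edges m (k - 1)) (f v)"
      using hom by (auto simp: incident_edges_def graph_homomorphism_def)
  next
    fix X assume "X \<in> incident_edges (kneser_edges m (k - 1)) (f v)"
    then obtain B where B: "X = {f v, B}" "X \<in> kneser_edges m (k - 1)"
      unfolding incident_edges_def kneser_edges_def by fast
    obtain u where "{v, u} \<in> E" "f u = B"
      using lift[OF v] kneser_neighbour[of "f v" B] B by metis
    with B have "{v, u} \<in> incident_edges E v" "X = f ` {v, u}" by (auto simp: incident_edges_def)
    then show "X \<in> (`) f ` incident_edges E v" by blast
  qed
  \<comment> \<open>By \<open>lift\<close>, the image of \<open>f\<close> is closed under taking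
    neighbours. As it is nonempty, connectedness makes it everything.\<close>
  have "B \<in> f ` V" if B: "B \<in> kneser_vertices m (k - 1)" for B
  proof -
    obtain v where "v \<in> V" using \<open>V \<noteq> {}\<close> by blast
    show ?thesis
    proof (rule kneser_odd_connected[OF _ _ _ _ B])
      show "m = 2 * (k - 1) + 1" using \<open>k > 0\<close> by (simp add: m_def)
      show "f ` V \<subseteq> kneser_vertices m (k - 1)" using fV by blast
      show "f v \<in> f ` V" using \<open>v \<in> V\<close> by blast
      fix A B assume "A \<in> f ` V" and B: "B \<in> kneser_vertices m (k - 1)" "A \<inter> B = {}"
      then obtain w where "w \<in> V" "A = f w" by blast
      then obtain u where "{w, u} \<in> E" "f u = B" using lift B by blast
      then show "B \<in> f ` V" using S by (auto simp: simple_graph_def)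
    qed
  qed
  with fV have "f ` V = kneser_vertices m (k - 1)" by blast
  with hom bij show ?thesis
    unfolding covers_def covering_projection_def m_def by blast
qed

section \<open>From a covering to a coloring with \<open>2 * k - 1\<close> colors\<close>

lemma strong_edge_coloring_of_covers_kneser:
  assumes S: "simple_graph V E" and "k > 0"
    and cov: "covers V E (kneser_vertices (2 * k - 1) (k - 1)) (kneser_edges (2 * k - 1) (k - 1))"
  obtains c :: "'a set \<Rightarrow> nat" where "strong_edge_coloring E c" "c ` E \<subseteq> {..<2 * k - 1}"
proof -
  define m where "m = 2 * k - 1"
  obtain f where f: "covering_projection f V E (kneser_vertices m (k - 1)) (kneser_edges m (k - 1))"
    using cov unfolding covers_def m_def by blast
  have hom: "\<forall>e\<in>E. f ` e \<in> kneser_edges m (k - 1)"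
    using f by (simp add: covering_projection_def graph_homomorphism_def)
  have inj: "inj_on ((`) f) (incident_edges E v)" if "v \<in> V" for v
    using f that by (auto simp: covering_projection_def bij_betw_def)
  \<comment> \<open>The color is the element outside both endpoint sets, shifted down by one to
    start at 0. On an edge it is unique, since two disjoint \<open>(k - 1)\<close>-sets leave one of
    \<open>2 * k - 1\<close> elements.\<close>
  define c where "c e = (THE j. j < m \<and> Suc j \<notin> \<Union>(f ` e))" for e
  have c: "c {u, v} < m \<and> f u = {1..m} - insert (Suc (c {u, v})) (f v)" if uv: "{u, v} \<in> E" for u v
  proof -
    have "{f u, f v} \<in> kneser_edges m (k - 1)" using bspec[OF hom uv] by simp
    note nb = kneser_neighbour[OF this]
    have sub: "f u \<subseteq> {1..m}" "f v \<subseteq> {1..m}" and card: "card (f u) = k - 1" "card (f v) = k - 1"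
      and fin: "finite (f u)" "finite (f v)"
      using nb by (auto simp: kneser_vertices_def dest: finite_subset)
    have "card ({1..m} - (f u \<union> f v)) = 1"
      using card_Diff_subset[of "f u \<union> f v" "{1..m}"] card_Un_disjoint[OF fin nb(3)] sub card fin \<open>k > 0\<close>
      by (simp add: m_def)
    then obtain x where x: "{1..m} - (f u \<union> f v) = {x}" by (auto simp: card_1_singleton_iff)
    then have iff: "1 \<le> y \<and> y \<le> m \<and> y \<notin> f u \<and> y \<notin> f v \<longleftrightarrow> y = x" for y
      by (metis Diff_iff Un_iff atLeastAtMost_iff singleton_iff)
    have xm: "1 \<le> x" "x \<le> m" "x \<notin> f u" "x \<notin> f v"
      using iff[of x] by blast+
    have "c {u, v} = x - 1"
      unfolding c_def
    proof (rule the_equality)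
      show "x - 1 < m \<and> Suc (x - 1) \<notin> \<Union>(f ` {u, v})" using xm by auto
      show "j = x - 1" if "j < m \<and> Suc j \<notin> \<Union>(f ` {u, v})" for j
        using iff[of "Suc j"] that by auto
    qed
    then have "Suc (c {u, v}) = x" "c {u, v} < m" using xm by auto
    moreover have "f u = {1..m} - insert x (f v)"
    proof (rule set_eqI)
      show "y \<in> f u \<longleftrightarrow> y \<in> {1..m} - insert x (f v)" for y
        using iff[of y] xm sub nb(3) by (auto simp: subset_iff)
    qed
    ultimately show ?thesis by simp
  qed
  \<comment> \<open>The color of an edge and the set at one end determine the set at the other.
    Equal colors at \<open>v\<close> would thus give two edges with the same image, against local
    injectivity of the covering.\<close>
  have proper: "c e \<noteq> c e'" if e: "e \<in> incident_edges E v" "e' \<in> incident_edges E v" "e \<noteq> e'" for v e e'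
  proof
    assume eq: "c e = c e'"
    obtain u where u: "e = {v, u}" "{v, u} \<in> E" "v \<in> V"
      using simple_graph_incident_edgeE[OF S e(1)] by blast
    obtain w where w: "e' = {v, w}" "{v, w} \<in> E"
      using simple_graph_incident_edgeE[OF S e(2)] by blast
    have "f u = f w"
      using c[of u v] c[of w v] u w eq by (simp add: insert_commute)
    then have "f ` e = f ` e'" using u w by simp
    then show False using inj_onD[OF inj[OF u(3)]] e by blast
  qed
  have "\<not> bichromatic_path3 E c u v w x" for u v w x
  proof
    assume "bichromatic_path3 E c u v w x"
    then have d: "distinct [u, v, w, x]" and E: "{u, v} \<in> E" "{v, w} \<in> E" "{w, x} \<in> E"
      and card: "card {c {u, v}, c {v, w}, c {w, x}} = 2"
      by (auto simp: bichromatic_path3_def)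
    have ne: "c {u, v} \<noteq> c {v, w}" "c {v, w} \<noteq> c {w, x}"
      using E d proper[of "{u, v}" v "{v, w}"] proper[of "{v, w}" w "{w, x}"]
      by (auto simp: incident_edges_def doubleton_eq_iff)
    \<comment> \<open>Consecutive edges differ in color, so only two colors in total forces the
      outer ones to agree.\<close>
    with card have eq: "c {u, v} = c {w, x}" by (auto simp: card_insert_if split: if_splits)
    have "Suc (c {u, v}) \<notin> f v"
      using c[of v u] E(1) by (auto simp: insert_commute)
    \<comment> \<open>Apart from the color of \<open>{v, w}\<close>, every element missing from
      \<open>f v\<close> lies in \<open>f w\<close>. The color of \<open>{w, x}\<close>, however,
      avoids \<open>f w\<close>, so the outer colors differ.\<close>
    then have "Suc (c {u, v}) \<in> f w"
      using c[OF E(2)] c[OF E(1)] ne by auto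
    moreover have "Suc (c {w, x}) \<notin> f w" using c[OF E(3)] by auto
    ultimately show False using eq by simp
  qed
  moreover have "proper_edge_coloring E c"
    unfolding proper_edge_coloring_def
  proof (intro ballI impI)
    fix e e' assume "e \<in> E" "e' \<in> E" "e \<noteq> e' \<and> e \<inter> e' \<noteq> {}"
    then obtain v where "e \<in> incident_edges E v" "e' \<in> incident_edges E v" "e \<noteq> e'"
      by (auto simp: incident_edges_def)
    then show "c e \<noteq> c e'" by (rule proper)
  qed
  ultimately have "strong_edge_coloring E c" by (simp add: strong_edge_coloring_def)
  moreover have "c e < 2 * k - 1" if "e \<in> E" for e
  proof -
    have "card e = 2" using S that by (simp add: simple_graph_def)
    then obtain u v where "e = {u, v}" by (auto simp: card_2_iff)
    with c that show ?thesis by (auto simp: m_def)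
  qed
  then have "c ` E \<subseteq> {..<2 * k - 1}" by auto
  ultimately show thesis by (rule that)
qed

section \<open>The equivalence\<close>

theorem theorem4:
  fixes k :: nat and V :: "'a set" and E :: "'a set set"
  assumes "k \<ge> 3"
    and "regular_graph k V E"
  shows "strong_chromatic_index E = enat (2 * k - 1) \<longleftrightarrow>
         covers V E (kneser_vertices (2 * k - 1) (k - 1)) (kneser_edges (2 * k - 1) (k - 1))"
proof
  have "k > 0" using assms(1) by simp
  have S: "simple_graph V E" using assms(2) by (simp add: regular_graph_def)
  {
    assume chi: "strong_chromatic_index E = enat (2 * k - 1)"
    \<comment> \<open>The empty graph is regular of every degree, but its index is 0 rather than
      \<open>2 * k - 1\<close>.\<close>
    have "V \<noteq> {}"
    proof
      assume "V = {}"
      with S have "E = {}" by (auto simp: simple_graph_def)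
      then have "strong_chromatic_index E \<le> enat 0"
        unfolding strong_chromatic_index_def
        by (intro Inf_lower)
          (auto simp: strong_edge_coloring_def proper_edge_coloring_def bichromatic_path3_def)
      with chi \<open>k > 0\<close> show False by simp
    qed
    then show "covers V E (kneser_vertices (2 * k - 1) (k - 1)) (kneser_edges (2 * k - 1) (k - 1))"
      using strong_chromatic_index_attained[OF chi]
        covers_kneser_of_strong_edge_coloring[OF assms(2) \<open>k > 0\<close>] by metis
  }
  {
    assume cov: "covers V E (kneser_vertices (2 * k - 1) (k - 1)) (kneser_edges (2 * k - 1) (k - 1))"
    \<comment> \<open>A concrete Kneser vertex: as coverings are onto, it forces \<open>V\<close> to
      be nonempty, which the lower bound on the number of colors requires.\<close>
    have "{1..k - 1} \<in> kneser_vertices (2 * k - 1) (k - 1)" by (auto simp: kneser_vertices_def)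
    then have "V \<noteq> {}" using cov unfolding covers_def covering_projection_def by blast
    obtain c :: "'a set \<Rightarrow> nat" where c: "strong_edge_coloring E c" "c ` E \<subseteq> {..<2 * k - 1}"
      using strong_edge_coloring_of_covers_kneser[OF S \<open>k > 0\<close> cov] .
    show "strong_chromatic_index E = enat (2 * k - 1)"
    proof (rule antisym)
      show "strong_chromatic_index E \<le> enat (2 * k - 1)"
        unfolding strong_chromatic_index_def using c by (intro Inf_lower) blast
      show "enat (2 * k - 1) \<le> strong_chromatic_index E"
        unfolding strong_chromatic_index_def
        using strong_edge_coloring_card_le[OF assms(2) \<open>k > 0\<close> \<open>V \<noteq> {}\<close>]
        by (intro Inf_greatest) auto
    qed
  }
qed

end
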